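(* Let $G_\tau$ be a bidirected graph and $\mathrm{Rt}(G_\tau)$ a transitive reduction of $G_\tau$. Then $r(M(\mathrm{Ft}(G_\tau)))=r(M(G_\tau))=r(M(\mathrm{Rt}(G_\tau)))$, where $r$ denotes the rank of the matroid.
   Context: A graph $G=(V,E)$ is finite, with loops and multiple edges allowed. A half-edge is a pair $(e,x)$ with $e$ incident with $x$ (a loop has two half-edges at its vertex). A bidirected graph $G_\tau=(V,E;\tau)$ is a graph with a map $\tau$ assigning $+1$ or $-1$ to every half-edge; an edge with ends $x,y$ and $\tau(e,x)=\alpha,\tau(e,y)=\beta$ is written $\{x^\alpha,y^\beta\}$ and has sign $-\alpha\beta$; a cycle is positive if it has an even number of negative edges and negative otherwise. The matroid $M(G_\tau)$ is the matroid on $E$ whose circuits are exactly: the edge sets of positive cycles; unions of two negative cycles having exactly one common vertex; and unions of two vertex-disjoint negative cycles together with an elementary chain joining them that is internally disjoint from both. Its rank is $|V|-b(G_\tau)$, where $b(G_\tau)$ is the number of connected components all of whose cycles are positive. A partial graph of $G_\tau$ is $(V,F;\tau|_F)$ with $F\subseteq E$. A chain is $x_0,e_1,x_1,\ldots,e_k,x_k$ where $e_i$ has ends $x_{i-1},x_i$; when $e_i$ is traversed from $x_{i-1}$ to $x_i$, $\tau(e_i,x_{i-1}),\tau(e_i,x_i)$ denote the values at the corresponding half-edges. For $\alpha,\beta\in\{\pm1\}$ a b-walk from $x^\alpha$ to $y^\beta$ is a chain $x=x_0,e_1,\ldots,e_k,x_k=y$ with $k\ge1$, $\tau(e_1,x_0)=\alpha$,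 $\tau(e_k,x_k)=\beta$ and $\tau(e_i,x_i)+\tau(e_{i+1},x_i)=0$ for $1\le i\le k-1$. A b-path from $x^\alpha$ to $y^\beta$ is a b-walk from $x^\alpha$ to $y^\beta$ minimal with these properties (no b-walk from $x^\alpha$ to $y^\beta$ has as edge sequence a proper subsequence, in the same order, of its edge sequence); $x=y$ allowed. The transitive closure $\mathrm{Ft}(G_\tau)$ is the bidirected graph on $V$ whose edges are those of $G_\tau$ together with an edge $\{x^\alpha,y^\beta\}$ (a loop if $x=y$) for every $x^\alpha,y^\beta$ such that $G_\tau$ has a b-path from $x^\alpha$ to $y^\beta$. For a partial graph $H_\tau$ of $G_\tau$, $\mathrm{ft}(G_\tau;H_\tau)$ is the partial graph of $G_\tau$ whose edges are the edges of $G_\tau$ that are edges of $H_\tau$ or are of the form $\{x^\alpha,y^\beta\}$ with a b-path from $x^\alpha$ to $y^\beta$ in $H_\tau$. A transitive reduction of $G_\tau$ is a minimal partial graph $R$ of $G_\tau$ with $\mathrm{ft}(G_\tau;R)=G_\tau$. *)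

theory Defs
  imports Complex_Main "HOL-Library.Multiset" "HOL-Library.Sublist"
begin

text \<open>
  A signed vertex \<open>(x, \<alpha>)\<close> with \<open>\<alpha> = \<plusminus>1\<close> stands for \<open>x\<^sup>\<alpha>\<close>. The incidence and the map \<open>\<tau>\<close> are given
  together: \<open>half G e\<close> is the two-element multiset of the half-edges of \<open>e\<close>, each recorded as its
  vertex with its sign, so an edge \<open>{x\<^sup>\<alpha>, y\<^sup>\<beta>}\<close> has \<open>half G e = {#(x, \<alpha>), (y, \<beta>)#}\<close>. A multiset is
  needed because of the loops \<open>{x\<^sup>\<alpha>, x\<^sup>\<alpha>}\<close>; parallel edges are distinct elements of \<open>edges G\<close>.
\<close>

type_synonym 'v svert = "'v \<times> int"

record ('v, 'e) bigraph =
  verts :: "'v set"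
  edges :: "'e set"
  half :: "'e \<Rightarrow> 'v svert multiset"

definition bidirected_graph :: "('v, 'e) bigraph \<Rightarrow> bool" where
  "bidirected_graph G \<longleftrightarrow> finite (verts G) \<and> finite (edges G) \<and>
     (\<forall>e\<in>edges G. \<exists>x\<in>verts G. \<exists>y\<in>verts G. \<exists>\<alpha>\<in>{1, -1}. \<exists>\<beta>\<in>{1, -1}.
        half G e = {#(x, \<alpha>), (y, \<beta>)#})"

definition edge_sign :: "('v, 'e) bigraph \<Rightarrow> 'e \<Rightarrow> int" where
  "edge_sign G e = - prod_mset (image_mset snd (half G e))"

definition verts_of :: "('v, 'e) bigraph \<Rightarrow> 'e set \<Rightarrow> 'v set" where
  "verts_of G F = (\<Union>e\<in>F. fst ` set_mset (half G e))"

text \<open>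
  A step \<open>(p, e, q)\<close> traverses \<open>e\<close> from its half-edge \<open>p\<close> to its half-edge \<open>q\<close>; a chain
  \<open>x\<^sub>0, e\<^sub>1, x\<^sub>1, \<dots>, e\<^sub>k, x\<^sub>k\<close> is its list of \<open>k\<close> steps. Recording both half-edges fixes the direction in
  which a loop is traversed.
\<close>

type_synonym ('v, 'e) step = "'v svert \<times> 'e \<times> 'v svert"

abbreviation step_src :: "('v, 'e) step \<Rightarrow> 'v svert" where
  "step_src s \<equiv> fst s"

abbreviation step_edge :: "('v, 'e) step \<Rightarrow> 'e" where
  "step_edge s \<equiv> fst (snd s)"

abbreviation step_tgt :: "('v, 'e) step \<Rightarrow> 'v svert" where
  "step_tgt s \<equiv> snd (snd s)"

fun chain :: "('v, 'e) bigraph \<Rightarrow> 'v \<Rightarrow> ('v, 'e) step list \<Rightarrow> 'v \<Rightarrow> bool" where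
  "chain G x [] y \<longleftrightarrow> x \<in> verts G \<and> x = y"
| "chain G x ((p, e, q) # ss) y \<longleftrightarrow>
     e \<in> edges G \<and> half G e = {#p, q#} \<and> fst p = x \<and> chain G (fst q) ss y"

definition chain_edges :: "('v, 'e) step list \<Rightarrow> 'e list" where
  "chain_edges ss = map step_edge ss"

definition chain_verts :: "'v \<Rightarrow> ('v, 'e) step list \<Rightarrow> 'v list" where
  "chain_verts x ss = x # map (\<lambda>s. fst (step_tgt s)) ss"

definition elementary_chain ::
    "('v, 'e) bigraph \<Rightarrow> 'v \<Rightarrow> ('v, 'e) step list \<Rightarrow> 'v \<Rightarrow> bool" where
  "elementary_chain G x ss y \<longleftrightarrow> chain G x ss y \<and> distinct (chain_verts x ss)"

text \<open>
  Cycles are given by their edge sets. Loops and pairs of parallel edges are cycles; distinctness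
  of the edges excludes going back and forth along a single edge.
\<close>

definition cycle :: "('v, 'e) bigraph \<Rightarrow> 'e set \<Rightarrow> bool" where
  "cycle G C \<longleftrightarrow> (\<exists>x ss. ss \<noteq> [] \<and> chain G x ss x \<and> distinct (chain_edges ss) \<and>
     distinct (tl (chain_verts x ss)) \<and> C = set (chain_edges ss))"

definition positive_cycle :: "('v, 'e) bigraph \<Rightarrow> 'e set \<Rightarrow> bool" where
  "positive_cycle G C \<longleftrightarrow> cycle G C \<and> even (card {e\<in>C. edge_sign G e = -1})"

definition negative_cycle :: "('v, 'e) bigraph \<Rightarrow> 'e set \<Rightarrow> bool" where
  "negative_cycle G C \<longleftrightarrow> cycle G C \<and> odd (card {e\<in>C. edge_sign G e = -1})"

text \<open>
  The condition \<open>C1 \<noteq> C2\<close> matters: a negative loop has exactly one vertex in common with itself.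
\<close>

definition circuit :: "('v, 'e) bigraph \<Rightarrow> 'e set \<Rightarrow> bool" where
  "circuit G C \<longleftrightarrow>
     positive_cycle G C \<or>
     (\<exists>C1 C2. negative_cycle G C1 \<and> negative_cycle G C2 \<and> C1 \<noteq> C2 \<and>
        card (verts_of G C1 \<inter> verts_of G C2) = 1 \<and> C = C1 \<union> C2) \<or>
     (\<exists>C1 C2 x ss y. negative_cycle G C1 \<and> negative_cycle G C2 \<and>
        verts_of G C1 \<inter> verts_of G C2 = {} \<and>
        elementary_chain G x ss y \<and> x \<in> verts_of G C1 \<and> y \<in> verts_of G C2 \<and>
        (set (chain_verts x ss) - {x, y}) \<inter> (verts_of G C1 \<union> verts_of G C2) = {} \<and>
        C = C1 \<union> C2 \<union> set (chain_edges ss))"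

text \<open>A matroid is presented by its ground set and its set of circuits.\<close>

type_synonym 'e matroid = "'e set \<times> 'e set set"

definition independent :: "'e matroid \<Rightarrow> 'e set \<Rightarrow> bool" where
  "independent M I \<longleftrightarrow> I \<subseteq> fst M \<and> (\<forall>C\<in>snd M. \<not> C \<subseteq> I)"

definition matroid_rank :: "'e matroid \<Rightarrow> nat" where
  "matroid_rank M = Max (card ` {I. independent M I})"

definition bigraph_matroid :: "('v, 'e) bigraph \<Rightarrow> 'e matroid" where
  "bigraph_matroid G = (edges G, {C. circuit G C})"

definition b_walk ::
    "('v, 'e) bigraph \<Rightarrow> 'v svert \<Rightarrow> ('v, 'e) step list \<Rightarrow> 'v svert \<Rightarrow> bool" where
  "b_walk G p ss q \<longleftrightarrow> ss \<noteq> [] \<and> chain G (fst p) ss (fst q) \<and>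
     step_src (hd ss) = p \<and> step_tgt (last ss) = q \<and>
     (\<forall>i. Suc i < length ss \<longrightarrow> snd (step_tgt (ss ! i)) + snd (step_src (ss ! Suc i)) = 0)"

definition b_path ::
    "('v, 'e) bigraph \<Rightarrow> 'v svert \<Rightarrow> ('v, 'e) step list \<Rightarrow> 'v svert \<Rightarrow> bool" where
  "b_path G p ss q \<longleftrightarrow> b_walk G p ss q \<and>
     \<not> (\<exists>ss'. b_walk G p ss' q \<and> strict_subseq (chain_edges ss') (chain_edges ss))"

text \<open>
  The added edges are the unordered pairs \<open>{x\<^sup>\<alpha>, y\<^sup>\<beta>}\<close> themselves, so there is one of them for each
  such pair joined by a b-path.
\<close>

definition transitive_closure ::
    "('v, 'e) bigraph \<Rightarrow> ('v, 'e + 'v svert multiset) bigraph" where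
  "transitive_closure G =
     \<lparr>verts = verts G,
      edges = Inl ` edges G \<union> Inr ` {{#p, q#} | p q. \<exists>ss. b_path G p ss q},
      half = case_sum (half G) id\<rparr>"

definition partial_graph :: "('v, 'e) bigraph \<Rightarrow> ('v, 'e) bigraph \<Rightarrow> bool" where
  "partial_graph H G \<longleftrightarrow> verts H = verts G \<and> edges H \<subseteq> edges G \<and>
     (\<forall>e\<in>edges H. half H e = half G e)"

definition closure_in :: "('v, 'e) bigraph \<Rightarrow> ('v, 'e) bigraph \<Rightarrow> ('v, 'e) bigraph" where
  "closure_in G H = G\<lparr>edges := {e\<in>edges G. e \<in> edges H \<or>
     (\<exists>p q ss. half G e = {#p, q#} \<and> b_path H p ss q)}\<rparr>"

definition transitive_reduction :: "('v, 'e) bigraph \<Rightarrow> ('v, 'e) bigraph \<Rightarrow> bool" where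
  "transitive_reduction R G \<longleftrightarrow> partial_graph R G \<and> closure_in G R = G \<and>
     \<not> (\<exists>R'. partial_graph R' G \<and> closure_in G R' = G \<and> edges R' \<subset> edges R)"

end

theory Submission
  imports Defs "HOL-Library.Function_Algebras"
begin

text \<open>
  Represent an edge \<open>{x\<^sup>\<alpha>, y\<^sup>\<beta>}\<close> by the vector \<open>\<alpha> x + \<beta> y\<close> of the real vector space over the vertices.
  The circuit-free edge sets are exactly the linearly independent families, so the rank of the
  matroid is the dimension of the span of the edges. Along a b-walk from \<open>x\<^sup>\<alpha>\<close> to \<open>y\<^sup>\<beta>\<close> the terms of the
  internal vertices cancel and the edges sum to \<open>\<alpha> x + \<beta> y\<close>; hence neither the transitive closure
  nor a transitive reduction changes the span.

  That a dependent set contains a circuit is seen on the support of a linear relation, where every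
  end of an edge is an end of a further edge: a longest elementary chain then has a back edge at each
  of its ends, which yields a positive cycle or two negative cycles that meet in at most one vertex.
  If both back edges are the same edge, they close a cycle; a negative cycle is independent, so
  another edge of the support is attached to it and the chain can be rotated to end there.
\<close>

section \<open>The space of real functions on the vertices\<close>

text \<open>The scaling that the locale \<open>vector_space\<close> takes as its parameter; span,
  dependence and the dimension bound then come from the interpretation \<open>funs\<close>.\<close>

definition fscale :: "real \<Rightarrow> ('a \<Rightarrow> real) \<Rightarrow> 'a \<Rightarrow> real" where
  "fscale c f = (\<lambda>x. c * f x)"

lemma fscale_apply: "fscale c f x = c * f x"
  by (simp add: fscale_def)

interpretation funs: vector_space "fscale :: real \<Rightarrow> ('a \<Rightarrow> real) \<Rightarrow> 'a \<Rightarrow> real"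
  by unfold_locales (simp_all add: fscale_apply fun_eq_iff algebra_simps)

lemma sum_fun_apply: "(\<Sum>a\<in>A. f a) x = (\<Sum>a\<in>A. (f a x :: real))"
  by (induction A rule: infinite_finite_induct) simp_all

definition unit_vec :: "'a \<Rightarrow> 'a \<Rightarrow> real" where
  "unit_vec x = (\<lambda>v. if v = x then 1 else 0)"

lemma unit_vec_apply [simp]: "unit_vec x v = (if v = x then 1 else 0)"
  by (simp add: unit_vec_def)

lemma inj_unit_vec: "inj_on unit_vec A"
  by (auto simp: inj_on_def unit_vec_def fun_eq_iff split: if_splits)

text \<open>Evaluation at \<open>x\<close> annihilates every unit vector except
  \<open>unit_vec x\<close>, so it isolates the coefficient of that vector.\<close>

lemma independent_unit_vec: "\<not> funs.dependent (unit_vec ` A)"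
proof
  assume "funs.dependent (unit_vec ` A)"
  then obtain t u w where t: "finite t" "t \<subseteq> unit_vec ` A" "(\<Sum>v\<in>t. fscale (u v) v) = 0"
    and w: "w \<in> t" "u w \<noteq> 0"
    by (auto simp: funs.dependent_explicit)
  obtain x where x: "w = unit_vec x" using t w by auto
  have "0 = (\<Sum>v\<in>t. fscale (u v) v) x" using t by simp
  also have "\<dots> = (\<Sum>v\<in>t. u v * v x)" by (simp add: sum_fun_apply fscale_apply)
  also have "\<dots> = (\<Sum>v\<in>t. if v = w then u w else 0)"
    using t(2) x by (intro sum.cong) (auto split: if_splits)
  also have "\<dots> = u w" using t w by simp
  finally show False using w by simp
qed

section \<open>Linear dependence of indexed families\<close>

text \<open>Dependence is attached to indices and not to the set of values: parallel edges can have
  the same vector, and a set of vectors would merge them.\<close>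

definition family_dependent :: "('e \<Rightarrow> 'a \<Rightarrow> real) \<Rightarrow> 'e set \<Rightarrow> bool" where
  "family_dependent f I \<longleftrightarrow> (\<exists>e\<in>I. f e \<in> funs.span (f ` (I - {e})))"

lemma family_dependent_mono: "family_dependent f I \<Longrightarrow> I \<subseteq> J \<Longrightarrow> family_dependent f J"
  unfolding family_dependent_def
  by (meson Diff_mono funs.span_mono image_mono order_refl subset_iff)

lemma family_dependent_iff:
  "family_dependent f I \<longleftrightarrow> \<not> (inj_on f I \<and> \<not> funs.dependent (f ` I))"
proof
  assume "family_dependent f I"
  then obtain e where e: "e \<in> I" "f e \<in> funs.span (f ` (I - {e}))"
    by (auto simp: family_dependent_def)
  show "\<not> (inj_on f I \<and> \<not> funs.dependent (f ` I))"
  proof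
    assume a: "inj_on f I \<and> \<not> funs.dependent (f ` I)"
    then have "f ` (I - {e}) = f ` I - {f e}"
      using e by (auto simp: inj_on_def)
    with a e show False by (auto simp: funs.dependent_def)
  qed
next
  assume n: "\<not> (inj_on f I \<and> \<not> funs.dependent (f ` I))"
  show "family_dependent f I"
  proof (cases "inj_on f I")
    case False
    then obtain a b where "a \<in> I" "b \<in> I" "a \<noteq> b" "f a = f b" by (auto simp: inj_on_def)
    then have "f a \<in> f ` (I - {a})" by auto
    then have "f a \<in> funs.span (f ` (I - {a}))" by (rule funs.span_base)
    then show ?thesis using \<open>a \<in> I\<close> by (auto simp: family_dependent_def)
  next
    case True
    with n obtain e where e: "e \<in> I" "f e \<in> funs.span (f ` I - {f e})"
      by (auto simp: funs.dependent_def)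
    have "f ` I - {f e} \<subseteq> f ` (I - {e})" by auto
    then have "f e \<in> funs.span (f ` (I - {e}))" using e(2) funs.span_mono by blast
    then show ?thesis using e(1) by (auto simp: family_dependent_def)
  qed
qed

text \<open>The coefficients are indexed by \<open>A\<close>, so they can be read as weights of
  edges even where \<open>f\<close> is not injective. Adding a multiple of \<open>f a\<close> only
  changes the weight of \<open>a\<close>.\<close>

lemma span_image_explicit:
  assumes "finite A" "x \<in> funs.span (f ` A)"
  shows "\<exists>c. x = (\<Sum>a\<in>A. fscale (c a) (f a))"
  using assms(2)
proof (induction rule: funs.span_induct_alt)
  case base
  show ?case by (rule exI[of _ "\<lambda>_. 0"]) (simp add: fun_eq_iff sum_fun_apply fscale_apply)
next
  case (step k v y)
  then obtain a c where a: "a \<in> A" "v = f a" and c: "y = (\<Sum>a\<in>A. fscale (c a) (f a))" by blast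
  have "(\<Sum>b\<in>A. fscale ((c(a := c a + k)) b) (f b)) =
      (\<Sum>b\<in>A. fscale (c b) (f b) + (if b = a then fscale k (f a) else 0))"
    by (intro sum.cong) (auto simp: fscale_apply fun_eq_iff algebra_simps)
  also have "\<dots> = y + fscale k v"
    using a assms(1) by (simp add: sum.distrib c)
  finally show ?case by (metis add.commute)
qed

lemma family_dependent_imp_relation:
  assumes "finite I" "family_dependent f I"
  shows "\<exists>c. (\<Sum>e\<in>I. fscale (c e) (f e)) = 0 \<and> (\<exists>e\<in>I. c e \<noteq> 0)"
proof -
  obtain e where e: "e \<in> I" "f e \<in> funs.span (f ` (I - {e}))"
    using assms by (auto simp: family_dependent_def)
  then obtain c where c: "f e = (\<Sum>a\<in>I - {e}. fscale (c a) (f a))"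
    using span_image_explicit[of "I - {e}" "f e" f] assms by auto
  \<comment> \<open>The weight -1 cancels \<open>f e\<close> against its expansion and is the
    nonzero coefficient sought.\<close>
  have "(\<Sum>a\<in>I. fscale ((c(e := -1)) a) (f a)) =
      fscale (-1) (f e) + (\<Sum>a\<in>I - {e}. fscale ((c(e := -1)) a) (f a))"
    using assms e by (simp add: sum.remove)
  also have "(\<Sum>a\<in>I - {e}. fscale ((c(e := -1)) a) (f a)) = f e"
    unfolding c by (intro sum.cong) auto
  also have "fscale (-1) (f e) + f e = 0" by (simp add: fscale_apply fun_eq_iff)
  finally show ?thesis using e(1) by (metis fun_upd_same zero_neq_neg_one)
qed

lemma relation_imp_family_dependent:
  assumes "finite I" "(\<Sum>e\<in>I. fscale (c e) (f e)) = 0" "e \<in> I" "c e \<noteq> 0"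
  shows "family_dependent f I"
proof -
  have "fscale (c e) (f e) + (\<Sum>a\<in>I - {e}. fscale (c a) (f a)) = 0"
    using assms by (simp add: sum.remove)
  then have "f e = fscale (- 1 / c e) (\<Sum>a\<in>I - {e}. fscale (c a) (f a))"
    using assms(4) by (auto simp: fscale_apply fun_eq_iff field_simps add_eq_0_iff)
  moreover have "fscale (- 1 / c e) (\<Sum>a\<in>I - {e}. fscale (c a) (f a)) \<in> funs.span (f ` (I - {e}))"
    by (intro funs.span_scale funs.span_sum funs.span_base) auto
  ultimately show ?thesis using assms(3) unfolding family_dependent_def by metis
qed

section \<open>Chains and cycles\<close>

lemma pair_mset_eq_iff: "{#a, b#} = {#p, q#} \<longleftrightarrow> a = p \<and> b = q \<or> a = q \<and> b = p"
  by (auto simp: add_eq_conv_ex)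

lemma chain_edges_simps [simp]:
  "chain_edges [] = []" "chain_edges (s # ss) = step_edge s # chain_edges ss"
  "chain_edges (ss @ ts) = chain_edges ss @ chain_edges ts"
  by (simp_all add: chain_edges_def)

text \<open>The starting vertex is left out, so that a closed chain does not list its base vertex at
  both ends.\<close>

definition step_verts :: "('v, 'e) step list \<Rightarrow> 'v list" where
  "step_verts ss = map (\<lambda>s. fst (step_tgt s)) ss"

lemma step_verts_simps [simp]:
  "step_verts [] = []" "step_verts (s # ss) = fst (step_tgt s) # step_verts ss"
  "step_verts (ss @ ts) = step_verts ss @ step_verts ts" "length (step_verts ss) = length ss"
  by (simp_all add: step_verts_def)

lemma chain_verts_eq: "chain_verts x ss = x # step_verts ss"
  by (simp add: chain_verts_def step_verts_def)

text \<open>Multiplicative form of the parity of negative edges, compatible with concatenation and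
  reversal.\<close>

definition chain_sign :: "('v, 'e) bigraph \<Rightarrow> ('v, 'e) step list \<Rightarrow> int" where
  "chain_sign G ss = prod_list (map (edge_sign G) (chain_edges ss))"

lemma chain_sign_simps [simp]:
  "chain_sign G [] = 1" "chain_sign G (s # ss) = edge_sign G (step_edge s) * chain_sign G ss"
  "chain_sign G (ss @ ts) = chain_sign G ss * chain_sign G ts"
  by (simp_all add: chain_sign_def)

definition rev_chain :: "('v, 'e) step list \<Rightarrow> ('v, 'e) step list" where
  "rev_chain ss = rev (map (\<lambda>(p, e, q). (q, e, p)) ss)"

lemma rev_chain_simps [simp]:
  "rev_chain [] = []" "rev_chain ((p, e, q) # ss) = rev_chain ss @ [(q, e, p)]"
  by (simp_all add: rev_chain_def)

lemma length_rev_chain [simp]: "length (rev_chain ss) = length ss"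
  by (simp add: rev_chain_def)

lemma chain_edges_rev_chain [simp]: "chain_edges (rev_chain ss) = rev (chain_edges ss)"
  by (induction ss) auto

lemma chain_sign_rev_chain [simp]: "chain_sign G (rev_chain ss) = chain_sign G ss"
  by (induction ss) auto

text \<open>Links the product of signs with the count of negative edges; distinctness makes the
  product over the list agree with a count over the set.\<close>

lemma prod_list_signs:
  assumes "distinct es" "\<forall>e\<in>set es. f e \<in> {1, -1::int}"
  shows "prod_list (map f es) = (-1) ^ card {e \<in> set es. f e = -1}"
  using assms
proof (induction es)
  case (Cons a es)
  have "{e \<in> set (a # es). f e = -1} =
      (if f a = -1 then insert a {e \<in> set es. f e = -1} else {e \<in> set es. f e = -1})"
    by auto
  then show ?case using Cons by auto
qed simp

text \<open>Keeps the base vertex and the direction, which \<open>cycle\<close> hides, because the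
  arguments open a cycle at a chosen vertex.\<close>

definition is_cycle :: "('v, 'e) bigraph \<Rightarrow> 'v \<Rightarrow> ('v, 'e) step list \<Rightarrow> bool" where
  "is_cycle G x ss \<longleftrightarrow> ss \<noteq> [] \<and> chain G x ss x \<and> distinct (chain_edges ss) \<and>
     distinct (step_verts ss)"

lemma cycle_iff: "cycle G C \<longleftrightarrow> (\<exists>x ss. is_cycle G x ss \<and> C = set (chain_edges ss))"
  unfolding cycle_def is_cycle_def chain_verts_eq by auto

text \<open>The column of the signed incidence matrix. Summing over the multiset gives a loop with
  equal signs the coefficient +2 or -2 and a loop with opposite signs the zero vector.\<close>

definition edge_vec :: "('v, 'e) bigraph \<Rightarrow> 'e \<Rightarrow> 'v \<Rightarrow> real" where
  "edge_vec G e = (\<Sum>p\<in>#half G e. fscale (real_of_int (snd p)) (unit_vec (fst p)))"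

lemma edge_vec_pair:
  "half G e = {#p, q#} \<Longrightarrow> edge_vec G e =
     fscale (real_of_int (snd p)) (unit_vec (fst p)) + fscale (real_of_int (snd q)) (unit_vec (fst q))"
  by (simp add: edge_vec_def)

lemma edge_sign_pair: "half G e = {#p, q#} \<Longrightarrow> edge_sign G e = - (snd p * snd q)"
  by (simp add: edge_sign_def)

locale bidirected =
  fixes G :: "('v, 'e) bigraph"
  assumes bidirected: "bidirected_graph G"
begin

lemma finite_verts: "finite (verts G)" and finite_edges: "finite (edges G)"
  using bidirected by (auto simp: bidirected_graph_def)

lemma half_pair:
  assumes "e \<in> edges G"
  obtains p q where "half G e = {#p, q#}"
  using assms bidirected by (fastforce simp: bidirected_graph_def)

lemma half_in:
  assumes "e \<in> edges G" "half G e = {#p, q#}"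
  shows "fst p \<in> verts G" "fst q \<in> verts G" "snd p \<in> {1, -1}" "snd q \<in> {1, -1}"
proof -
  obtain x y a b where "x \<in> verts G" "y \<in> verts G" "a \<in> {1, -1::int}" "b \<in> {1, -1::int}"
    "half G e = {#(x, a), (y, b)#}"
    using assms(1) bidirected by (fastforce simp: bidirected_graph_def)
  then have "fst p \<in> verts G \<and> fst q \<in> verts G \<and> snd p \<in> {1, -1} \<and> snd q \<in> {1, -1}"
    using assms(2) by (auto simp: pair_mset_eq_iff)
  then show "fst p \<in> verts G" "fst q \<in> verts G" "snd p \<in> {1, -1}" "snd q \<in> {1, -1}" by auto
qed

lemma half_at:
  assumes "e \<in> edges G" "x \<in> verts_of G {e}"
  obtains p q where "half G e = {#p, q#}" "fst p = x"
proof -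
  obtain p q where pq: "half G e = {#p, q#}" using half_pair assms by blast
  then have "half G e = {#q, p#}" by (simp add: add_mset_commute)
  moreover have "x = fst p \<or> x = fst q" using pq assms(2) by (auto simp: verts_of_def)
  ultimately show ?thesis using that pq by metis
qed

lemma edge_sign_in: "e \<in> edges G \<Longrightarrow> edge_sign G e \<in> {1, -1}"
  by (metis (no_types, lifting) edge_sign_pair half_in(3,4) half_pair insertE insertI1 insertI2
      minus_minus mult.left_neutral mult_minus1 singletonD)

lemma chain_in_verts: "chain G x ss y \<Longrightarrow> x \<in> verts G \<and> y \<in> verts G"
proof (induction ss arbitrary: x)
  case (Cons s ss)
  then show ?case using half_in(1) by (cases s) auto
qed simp

lemma chain_append:
  "chain G x (ss @ ts) y \<longleftrightarrow> (\<exists>z. chain G x ss z \<and> chain G z ts y)"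
proof (induction ss arbitrary: x)
  case Nil
  then show ?case using chain_in_verts by auto
next
  case (Cons s ss)
  then show ?case by (cases s) auto
qed

lemma chain_edges_subset: "chain G x ss y \<Longrightarrow> set (chain_edges ss) \<subseteq> edges G"
  by (induction ss arbitrary: x) fastforce+

lemma chain_rev: "chain G x ss y \<Longrightarrow> chain G y (rev_chain ss) x"
proof (induction ss arbitrary: x)
  case (Cons s ss)
  obtain p e q where s: "s = (p, e, q)" by (cases s)
  then show ?case using Cons half_in(1)[of e p q]
    by (auto simp: chain_append add_mset_commute)
qed simp

lemma chain_verts_rev: "chain G x ss y \<Longrightarrow> y # step_verts (rev_chain ss) = rev (x # step_verts ss)"
proof (induction ss arbitrary: x)
  case (Cons s ss)
  obtain p e q where s: "s = (p, e, q)" by (cases s)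
  then show ?case using Cons by auto
qed simp

lemma chain_last: "chain G x ss y \<Longrightarrow> y \<in> set (x # step_verts ss)"
  by (induction ss arbitrary: x) force+

lemma chain_verts_of: "chain G x ss y \<Longrightarrow> verts_of G (set (chain_edges ss)) \<subseteq> set (x # step_verts ss)"
proof (induction ss arbitrary: x)
  case (Cons s ss)
  obtain p e q where s: "s = (p, e, q)" by (cases s)
  then show ?case using Cons by (fastforce simp: verts_of_def)
qed (simp add: verts_of_def)

lemma chain_verts_of_supset: "chain G x ss y \<Longrightarrow> set (step_verts ss) \<subseteq> verts_of G (set (chain_edges ss))"
proof (induction ss arbitrary: x)
  case (Cons s ss)
  obtain p e q where s: "s = (p, e, q)" by (cases s)
  then show ?case using Cons by (fastforce simp: verts_of_def)
qed simp

lemma chain_split: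
  assumes "chain G x ss y" "v \<in> set (x # step_verts ss)"
  obtains s1 s2 where "ss = s1 @ s2" "chain G x s1 v" "chain G v s2 y"
  using assms
proof (induction ss arbitrary: x thesis)
  case Nil
  then show ?case by auto
next
  case (Cons s ss)
  obtain p e q where s: "s = (p, e, q)" by (cases s)
  show ?case
  proof (cases "v = x")
    case True
    show ?thesis
      using Cons.prems(1)[of "[]" "s # ss"] Cons.prems(2) True chain_in_verts by auto
  next
    case False
    then have v: "v \<in> set (fst q # step_verts ss)" using Cons.prems s by auto
    obtain s1 s2 where "ss = s1 @ s2" "chain G (fst q) s1 v" "chain G v s2 y"
      using Cons.IH[OF _ _ v] Cons.prems(2) s by auto
    then show ?thesis using Cons.prems(1)[of "s # s1" s2] Cons.prems(2) s by auto
  qed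
qed

text \<open>The last step returns to \<open>x\<close>, so \<open>step_verts\<close> misses no vertex
  although it omits the start.\<close>

lemma is_cycle_verts_of:
  assumes "is_cycle G x ss"
  shows "verts_of G (set (chain_edges ss)) = set (step_verts ss)" "x \<in> set (step_verts ss)"
proof -
  have c: "chain G x ss x" "ss \<noteq> []" using assms by (auto simp: is_cycle_def)
  obtain ts s where ss: "ss = ts @ [s]" using c by (metis append_butlast_last_id)
  obtain p e q where s: "s = (p, e, q)" by (cases s)
  have "fst q = x" using c ss s by (auto simp: chain_append)
  then show x: "x \<in> set (step_verts ss)" using ss s by auto
  show "verts_of G (set (chain_edges ss)) = set (step_verts ss)"
    using chain_verts_of[OF c(1)] chain_verts_of_supset[OF c(1)] x by auto
qed

text \<open>Cut the closed chain at \<open>v\<close> and exchange the two pieces.\<close>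

lemma cycle_rotate:
  assumes "cycle G C" "v \<in> verts_of G C"
  obtains ss where "is_cycle G v ss" "C = set (chain_edges ss)"
proof -
  obtain x ss where c: "is_cycle G x ss" "C = set (chain_edges ss)"
    using assms by (auto simp: cycle_iff)
  have "v \<in> set (x # step_verts ss)" using is_cycle_verts_of[OF c(1)] assms c by auto
  then obtain s1 s2 where s: "ss = s1 @ s2" "chain G x s1 v" "chain G v s2 x"
    using chain_split c(1) unfolding is_cycle_def by metis
  then have "is_cycle G v (s2 @ s1)" using c by (auto simp: is_cycle_def chain_append)
  moreover have "C = set (chain_edges (s2 @ s1))" using c s by auto
  ultimately show ?thesis by (rule that)
qed

lemma chain_sign_card:
  assumes "chain G x ss y" "distinct (chain_edges ss)"
  shows "chain_sign G ss = (-1) ^ card {e \<in> set (chain_edges ss). edge_sign G e = -1}"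
  unfolding chain_sign_def
  using assms chain_edges_subset[OF assms(1)] edge_sign_in by (intro prod_list_signs) blast+

lemma positive_cycleI:
  assumes "is_cycle G x ss" "chain_sign G ss = 1"
  shows "positive_cycle G (set (chain_edges ss))"
  using assms chain_sign_card[of x ss x] unfolding positive_cycle_def cycle_iff
  by (auto simp: is_cycle_def minus_one_power_iff split: if_splits)

lemma negative_cycleI:
  assumes "is_cycle G x ss" "chain_sign G ss \<noteq> 1"
  shows "negative_cycle G (set (chain_edges ss))"
  using assms chain_sign_card[of x ss x] unfolding negative_cycle_def cycle_iff
  by (auto simp: is_cycle_def minus_one_power_iff split: if_splits)

lemma positive_cycle_sign:
  assumes "positive_cycle G (set (chain_edges ss))" "is_cycle G x ss"
  shows "chain_sign G ss = 1"
  using assms chain_sign_card[of x ss x]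
  by (auto simp: positive_cycle_def is_cycle_def)

lemma negative_cycle_sign:
  assumes "negative_cycle G (set (chain_edges ss))" "is_cycle G x ss"
  shows "chain_sign G ss = -1"
  using assms chain_sign_card[of x ss x]
  by (auto simp: negative_cycle_def is_cycle_def)

lemma chain_sign_in: "chain G x ss y \<Longrightarrow> chain_sign G ss \<in> {1, -1}"
proof (induction ss arbitrary: x)
  case (Cons s ss)
  obtain p e q where s: "s = (p, e, q)" by (cases s)
  then show ?case using Cons edge_sign_in[of e] by fastforce
qed simp

lemma circuit_subset: "circuit G C \<Longrightarrow> C \<subseteq> edges G"
proof -
  have c: "C \<subseteq> edges G" if "cycle G C" for C
    using that chain_edges_subset by (fastforce simp: cycle_iff is_cycle_def)
  assume "circuit G C"
  then show ?thesis
    unfolding circuit_def positive_cycle_def negative_cycle_def elementary_chain_def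
    using c chain_edges_subset by blast
qed


section \<open>Circuits are linearly dependent\<close>

text \<open>Scaling by \<open>snd p\<close> makes the coefficient at \<open>fst p\<close> a square,
  hence 1, and the one at \<open>fst q\<close> equal to \<open>snd p * snd q\<close>, which is minus
  the sign of the edge.\<close>

lemma edge_vec_step:
  assumes "e \<in> edges G" "half G e = {#p, q#}"
  shows "unit_vec (fst p) - fscale (real_of_int (edge_sign G e)) (unit_vec (fst q)) =
           fscale (real_of_int (snd p)) (edge_vec G e)"
  using half_in(3,4)[OF assms] unfolding edge_vec_pair[OF assms(2)] edge_sign_pair[OF assms(2)]
  by (auto simp: fscale_apply fun_eq_iff)

text \<open>Modulo the span of its edges, each step replaces the unit vector of its source by the
  edge sign times that of its target; the signs multiply along the chain.\<close>

lemma chain_span: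
  "chain G x ss y \<Longrightarrow>
    unit_vec x - fscale (real_of_int (chain_sign G ss)) (unit_vec y) \<in>
      funs.span (edge_vec G ` set (chain_edges ss))"
proof (induction ss arbitrary: x)
  case Nil
  then have "unit_vec x - fscale (real_of_int (chain_sign G [])) (unit_vec y) = 0"
    by (simp add: fscale_apply fun_eq_iff)
  then show ?case using funs.span_zero by metis
next
  case (Cons s ss)
  obtain p e q where s: "s = (p, e, q)" by (cases s)
  have e: "e \<in> edges G" "half G e = {#p, q#}" "fst p = x" "chain G (fst q) ss y"
    using Cons.prems s by auto
  let ?S = "funs.span (edge_vec G ` set (chain_edges (s # ss)))"
  have "unit_vec (fst q) - fscale (real_of_int (chain_sign G ss)) (unit_vec y) \<in>
      funs.span (edge_vec G ` set (chain_edges ss))"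
    using Cons.IH e by blast
  also have "\<dots> \<subseteq> ?S" by (intro funs.span_mono) auto
  finally have 1: "unit_vec (fst q) - fscale (real_of_int (chain_sign G ss)) (unit_vec y) \<in> ?S" .
  have "edge_vec G e \<in> ?S" using s by (intro funs.span_base) auto
  then have 2: "unit_vec x - fscale (real_of_int (edge_sign G e)) (unit_vec (fst q)) \<in> ?S"
    using edge_vec_step[OF e(1,2)] e(3) by (metis funs.span_scale)
  have "unit_vec x - fscale (real_of_int (chain_sign G (s # ss))) (unit_vec y) =
      (unit_vec x - fscale (real_of_int (edge_sign G e)) (unit_vec (fst q))) +
      fscale (real_of_int (edge_sign G e))
        (unit_vec (fst q) - fscale (real_of_int (chain_sign G ss)) (unit_vec y))"
    using s by (auto simp: fscale_apply fun_eq_iff algebra_simps)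
  then show ?case using funs.span_add[OF 2 funs.span_scale[OF 1]] by metis
qed

text \<open>Going once around from \<open>v\<close> with sign -1 puts twice
  \<open>unit_vec v\<close> into the span; halve it.\<close>

lemma negative_cycle_span:
  assumes "negative_cycle G C" "v \<in> verts_of G C"
  shows "unit_vec v \<in> funs.span (edge_vec G ` C)"
proof -
  obtain ss where ss: "is_cycle G v ss" "C = set (chain_edges ss)"
    using cycle_rotate assms unfolding negative_cycle_def by metis
  have "chain G v ss v" using ss by (simp add: is_cycle_def)
  from chain_span[OF this] negative_cycle_sign[of ss v] assms(1) ss
  have "unit_vec v - fscale (- 1) (unit_vec v) \<in> funs.span (edge_vec G ` C)" by simp
  then have "fscale (1/2) (unit_vec v - fscale (- 1) (unit_vec v)) \<in> funs.span (edge_vec G ` C)"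
    by (rule funs.span_scale)
  moreover have "fscale (1/2) (unit_vec v - fscale (- 1) (unit_vec v)) = unit_vec v"
    by (simp add: fscale_apply fun_eq_iff)
  ultimately show ?thesis by metis
qed

text \<open>A negative cycle of length \<open>n\<close> spans the \<open>n\<close> unit vectors of its vertices.\<close>

lemma negative_cycle_independent:
  assumes "negative_cycle G C"
  shows "\<not> family_dependent (edge_vec G) C"
proof
  assume "family_dependent (edge_vec G) C"
  then obtain e where e: "e \<in> C" "edge_vec G e \<in> funs.span (edge_vec G ` (C - {e}))"
    by (auto simp: family_dependent_def)
  obtain x ss where ss: "is_cycle G x ss" "C = set (chain_edges ss)"
    using assms by (auto simp: negative_cycle_def cycle_iff)
  have "edge_vec G ` C = insert (edge_vec G e) (edge_vec G ` (C - {e}))" using e by auto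
  then have sp: "funs.span (edge_vec G ` C) = funs.span (edge_vec G ` (C - {e}))"
    using funs.span_redundant[OF e(2)] by simp
  have sub: "unit_vec ` verts_of G C \<subseteq> funs.span (edge_vec G ` (C - {e}))"
    using negative_cycle_span[OF assms] sp by auto
  have fin: "finite C" using ss by simp
  then have "finite (edge_vec G ` (C - {e}))" by simp
  \<comment> \<open>Without the redundant edge \<open>e\<close> there are fewer generators than the
    independent unit vectors that they span.\<close>
  from funs.independent_span_bound[OF this independent_unit_vec sub]
  have "card (unit_vec ` verts_of G C) \<le> card (edge_vec G ` (C - {e}))" by (rule conjunct2)
  also have "\<dots> \<le> card (C - {e})" using fin by (simp add: card_image_le)
  also have "\<dots> < card C" using e fin by (metis card_Diff1_less)
  also have "card C = length ss"
    using ss by (simp add: is_cycle_def distinct_card) (simp add: chain_edges_def)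
  also have "\<dots> = card (verts_of G C)"
    using ss is_cycle_verts_of(1)[OF ss(1)] by (simp add: is_cycle_def distinct_card)
  also have "\<dots> = card (unit_vec ` verts_of G C)"
    using card_image[OF inj_unit_vec] by metis
  finally show False by simp
qed

text \<open>The cycle without its first edge \<open>e\<close> is a chain between the ends of
  \<open>e\<close> with the sign of \<open>e\<close>, so by \<open>chain_span\<close> its edges
  generate the vector of \<open>e\<close>.\<close>

lemma positive_cycle_dependent:
  assumes "positive_cycle G C"
  shows "family_dependent (edge_vec G) C"
proof -
  obtain x ss where ss: "is_cycle G x ss" "C = set (chain_edges ss)"
    using assms by (auto simp: positive_cycle_def cycle_iff)
  obtain p e q ts where s: "ss = (p, e, q) # ts"
    using ss by (cases ss) (auto simp: is_cycle_def)
  have e: "e \<in> edges G" "half G e = {#p, q#}" "fst p = x" "chain G (fst q) ts x"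
    using ss s by (auto simp: is_cycle_def)
  have Ce: "C - {e} = set (chain_edges ts)" using ss s by (auto simp: is_cycle_def)
  have "edge_sign G e * chain_sign G ts = 1" using positive_cycle_sign[of ss x] assms ss s by simp
  then have sg: "chain_sign G ts = edge_sign G e"
    using edge_sign_in[OF e(1)] by auto
  \<comment> \<open>This is \<open>edge_vec_step\<close> for \<open>e\<close> traversed from
    \<open>q\<close> to \<open>p\<close>, solved for the edge vector.\<close>
  have "edge_vec G e = fscale (real_of_int (snd q))
      (unit_vec (fst q) - fscale (real_of_int (edge_sign G e)) (unit_vec (fst p)))"
    using half_in(3,4)[OF e(1,2)] unfolding edge_vec_pair[OF e(2)] edge_sign_pair[OF e(2)]
    by (auto simp: fscale_apply fun_eq_iff)
  moreover have "unit_vec (fst q) - fscale (real_of_int (edge_sign G e)) (unit_vec (fst p))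
      \<in> funs.span (edge_vec G ` (C - {e}))"
    using chain_span[OF e(4)] sg e(3) Ce by simp
  ultimately have "edge_vec G e \<in> funs.span (edge_vec G ` (C - {e}))"
    by (metis funs.span_scale)
  then show ?thesis using ss s unfolding family_dependent_def by auto
qed

text \<open>Serves both kinds of circuits with two negative cycles, \<open>D\<close> being the rest
  of the circuit. From \<open>unit_vec v\<close>, the part of \<open>C\<close> left after removing
  an edge \<open>e\<close> at \<open>v\<close> yields the unit vector of the other end of
  \<open>e\<close>, hence the vector of \<open>e\<close>.\<close>

lemma negative_cycle_attached_dependent:
  assumes "negative_cycle G C" "v \<in> verts_of G C" "unit_vec v \<in> funs.span (edge_vec G ` D)"
    "C \<inter> D = {}"
  shows "family_dependent (edge_vec G) (C \<union> D)"
proof -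
  obtain ss where ss: "is_cycle G v ss" "C = set (chain_edges ss)"
    using cycle_rotate assms unfolding negative_cycle_def by metis
  obtain p e q ts where s: "ss = (p, e, q) # ts"
    using ss by (cases ss) (auto simp: is_cycle_def)
  have e: "e \<in> edges G" "half G e = {#p, q#}" "fst p = v" "chain G (fst q) ts v"
    using ss s by (auto simp: is_cycle_def)
  let ?S = "funs.span (edge_vec G ` (C \<union> D - {e}))"
  have "D \<subseteq> C \<union> D - {e}" "set (chain_edges ts) \<subseteq> C \<union> D - {e}"
    using ss s assms(4) by (auto simp: is_cycle_def)
  then have sub: "funs.span (edge_vec G ` D) \<subseteq> ?S"
    "funs.span (edge_vec G ` set (chain_edges ts)) \<subseteq> ?S"
    by (intro funs.span_mono image_mono; blast)+
  have v: "unit_vec v \<in> ?S" using sub assms(3) by auto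
  have 1: "unit_vec (fst q) - fscale (real_of_int (chain_sign G ts)) (unit_vec v) \<in> ?S"
    using chain_span[OF e(4)] sub by auto
  have q: "unit_vec (fst q) \<in> ?S"
    using funs.span_add[OF 1 funs.span_scale[OF v, of "real_of_int (chain_sign G ts)"]] by simp
  have "edge_vec G e \<in> ?S"
    unfolding edge_vec_pair[OF e(2)] using v q e(3) by (intro funs.span_add funs.span_scale) auto
  then show ?thesis using ss s unfolding family_dependent_def by auto
qed

text \<open>After rotation to start at \<open>v\<close>, any step before or after the loop
  \<open>e\<close> would make the cycle reach \<open>v\<close> twice. This serves to show that
  distinct cycles with a single common vertex share no edge.\<close>

lemma cycle_loop:
  assumes "cycle G C" "e \<in> C" "verts_of G {e} \<subseteq> {v}"
  shows "C = {e}"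
proof -
  have "e \<in> edges G" using assms chain_edges_subset by (fastforce simp: cycle_iff is_cycle_def)
  then obtain p q where "half G e = {#p, q#}" using half_pair by blast
  then have "v \<in> verts_of G {e}" using assms(3) by (auto simp: verts_of_def)
  then have "v \<in> verts_of G C" using assms(2) by (auto simp: verts_of_def)
  then obtain ss where ss: "is_cycle G v ss" "C = set (chain_edges ss)"
    using cycle_rotate assms by metis
  then obtain p q where "(p, e, q) \<in> set ss" using assms(2) by (auto simp: chain_edges_def)
  then obtain a b where ab: "ss = a @ (p, e, q) # b" by (meson split_list)
  have c: "chain G v a (fst p)" "half G e = {#p, q#}" "chain G (fst q) b v"
    using ss ab by (auto simp: is_cycle_def chain_append)
  then have pq: "fst p = v" "fst q = v" using assms(3) by (auto simp: verts_of_def)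
  have "b = []"
  proof (rule ccontr)
    assume "b \<noteq> []"
    then obtain b' s where b: "b = b' @ [s]" by (metis append_butlast_last_id)
    obtain p' e' q' where s: "s = (p', e', q')" by (cases s)
    have "fst q' = v" using c b s by (auto simp: chain_append)
    then show False using ss ab b s pq by (auto simp: is_cycle_def)
  qed
  moreover have "a = []"
  proof (rule ccontr)
    assume "a \<noteq> []"
    then obtain b' s where b: "a = b' @ [s]" by (metis append_butlast_last_id)
    obtain p' e' q' where s: "s = (p', e', q')" by (cases s)
    have "fst q' = v" using c b s pq by (auto simp: chain_append)
    then show False using ss ab b s pq by (auto simp: is_cycle_def)
  qed
  ultimately show ?thesis using ss ab by simp
qed

text \<open>Traversing a loop would list its vertex twice in succession.\<close>

lemma elementary_chain_no_loop:
  assumes "elementary_chain G x ss y" "e \<in> set (chain_edges ss)"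
  shows "\<not> verts_of G {e} \<subseteq> {v}"
proof
  assume v: "verts_of G {e} \<subseteq> {v}"
  have c: "chain G x ss y" "distinct (x # step_verts ss)"
    using assms by (auto simp: elementary_chain_def chain_verts_eq)
  obtain p q where "(p, e, q) \<in> set ss" using assms(2) by (auto simp: chain_edges_def)
  then obtain a b where ab: "ss = a @ (p, e, q) # b" by (meson split_list)
  have "chain G x a (fst p)" "half G e = {#p, q#}" using c ab by (auto simp: chain_append)
  then have "fst p \<in> set (x # step_verts a)" "fst p = v" "fst q = v"
    using chain_last v by (auto simp: verts_of_def)
  then show False using c ab by auto
qed

lemma verts_of_mono: "A \<subseteq> B \<Longrightarrow> verts_of G A \<subseteq> verts_of G B"
  by (auto simp: verts_of_def)

text \<open>For two negative cycles, the work is to show that the first is edge-disjoint from the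
  rest and that the rest spans the unit vector of the attaching vertex.\<close>

lemma circuit_dependent:
  assumes "circuit G C"
  shows "family_dependent (edge_vec G) C"
proof -
  have ne: "verts_of G {e} \<noteq> {}" if eC: "e \<in> C" for e
  proof -
    obtain p q where "half G e = {#p, q#}"
      using eC circuit_subset[OF assms] half_pair by blast
    then show ?thesis by (simp add: verts_of_def)
  qed
  consider "positive_cycle G C"
    | C1 C2 where "negative_cycle G C1" "negative_cycle G C2" "C1 \<noteq> C2"
        "card (verts_of G C1 \<inter> verts_of G C2) = 1" "C = C1 \<union> C2"
    | C1 C2 x ss y where "negative_cycle G C1" "negative_cycle G C2"
        "verts_of G C1 \<inter> verts_of G C2 = {}"
        "elementary_chain G x ss y" "x \<in> verts_of G C1" "y \<in> verts_of G C2"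
        "(set (chain_verts x ss) - {x, y}) \<inter> (verts_of G C1 \<union> verts_of G C2) = {}"
        "C = C1 \<union> C2 \<union> set (chain_edges ss)"
    using assms unfolding circuit_def by metis
  then show ?thesis
  proof cases
    case 1
    then show ?thesis by (rule positive_cycle_dependent)
  next
    case 2
    then obtain v where v: "verts_of G C1 \<inter> verts_of G C2 = {v}" by (metis card_1_singletonE)
    have "C1 \<inter> C2 = {}"
    proof (rule ccontr)
      assume "C1 \<inter> C2 \<noteq> {}"
      then obtain e where e: "e \<in> C1" "e \<in> C2" by auto
      \<comment> \<open>A common edge would be a loop at \<open>v\<close>, and then both cycles
        would equal \<open>{e}\<close>.\<close>
      then have "verts_of G {e} \<subseteq> {v}"
        using verts_of_mono[of "{e}" C1] verts_of_mono[of "{e}" C2] v by auto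
      then show False using cycle_loop e 2 unfolding negative_cycle_def by metis
    qed
    moreover have "unit_vec v \<in> funs.span (edge_vec G ` C2)"
      using negative_cycle_span 2 v by blast
    ultimately show ?thesis
      using negative_cycle_attached_dependent[of C1 v C2] 2 v by auto
  next
    case 3
    let ?E = "set (chain_edges ss)"
    have c: "chain G x ss y" using 3 by (simp add: elementary_chain_def)
    have "C1 \<inter> C2 = {}"
    proof (rule ccontr)
      assume "C1 \<inter> C2 \<noteq> {}"
      then obtain e where e: "e \<in> C1" "e \<in> C2" by auto
      then have "verts_of G {e} \<subseteq> {}" using verts_of_mono[of "{e}"] 3(3) by blast
      then show False using ne e 3 by auto
    qed
    moreover have "C1 \<inter> ?E = {}"
    proof (rule ccontr)
      assume "C1 \<inter> ?E \<noteq> {}"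
      then obtain e where e: "e \<in> C1" "e \<in> ?E" by auto
      have "verts_of G {e} \<subseteq> verts_of G C1" using e verts_of_mono[of "{e}"] by auto
      moreover have "verts_of G {e} \<subseteq> set (chain_verts x ss)"
        using e verts_of_mono[of "{e}" ?E] chain_verts_of[OF c] unfolding chain_verts_eq by auto
      \<comment> \<open>The only vertex of the chain on \<open>C1\<close> is \<open>x\<close>,
        because \<open>y\<close> lies on the disjoint \<open>C2\<close>; so a common edge would be a
        loop.\<close>
      ultimately have "verts_of G {e} \<subseteq> {x}" using 3(3,6,7) by blast
      then show False using elementary_chain_no_loop 3(4) e by metis
    qed
    ultimately have disj: "C1 \<inter> (C2 \<union> ?E) = {}" by auto
    let ?S = "funs.span (edge_vec G ` (C2 \<union> ?E))"
    have "unit_vec y \<in> funs.span (edge_vec G ` C2)" using negative_cycle_span 3 by blast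
    also have "\<dots> \<subseteq> ?S" by (intro funs.span_mono) auto
    finally have y: "unit_vec y \<in> ?S" .
    have "unit_vec x - fscale (real_of_int (chain_sign G ss)) (unit_vec y) \<in>
        funs.span (edge_vec G ` ?E)" by (rule chain_span[OF c])
    also have "\<dots> \<subseteq> ?S" by (intro funs.span_mono) auto
    finally have "unit_vec x - fscale (real_of_int (chain_sign G ss)) (unit_vec y) \<in> ?S" .
    \<comment> \<open>The unit vector at \<open>y\<close>, supplied by \<open>C2\<close>, is carried
      back along the chain to \<open>x\<close>.\<close>
    from funs.span_add[OF this funs.span_scale[OF y, of "real_of_int (chain_sign G ss)"]]
    have "unit_vec x \<in> ?S" by simp
    then show ?thesis
      using negative_cycle_attached_dependent[OF 3(1,5) _ disj] 3(8) by (simp add: Un_assoc)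
  qed
qed


section \<open>Circuit-free sets are linearly independent\<close>

lemma chain_end_unique: "chain G x ss y \<Longrightarrow> chain G x ss z \<Longrightarrow> y = z"
  by (induction ss arbitrary: x) auto

lemma chain_end_in_step_verts: "chain G x ss y \<Longrightarrow> ss \<noteq> [] \<Longrightarrow> y \<in> set (step_verts ss)"
  by (induction ss arbitrary: x) (fastforce dest: chain_last)+

text \<open>If the first edge occurred again, its end \<open>x\<close> would be revisited.\<close>

lemma elementary_distinct_edges:
  "chain G x ss y \<Longrightarrow> distinct (x # step_verts ss) \<Longrightarrow> distinct (chain_edges ss)"
proof (induction ss arbitrary: x)
  case (Cons s ss)
  obtain p e q where s: "s = (p, e, q)" by (cases s)
  have c: "half G e = {#p, q#}" "fst p = x" "chain G (fst q) ss y"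
    using Cons.prems s by auto
  have "e \<notin> set (chain_edges ss)"
  proof
    assume "e \<in> set (chain_edges ss)"
    then have "x \<in> verts_of G (set (chain_edges ss))" using c by (force simp: verts_of_def)
    then show False using chain_verts_of[OF c(3)] Cons.prems s by auto
  qed
  then show ?case using Cons s c by auto
qed simp

text \<open>The empty chain is included: the closing edge is then a loop at
  \<open>x\<close>.\<close>

lemma is_cycle_close:
  assumes "chain G x ss y" "distinct (x # step_verts ss)"
    "e \<in> edges G" "half G e = {#p, q#}" "fst p = y" "fst q = x" "e \<notin> set (chain_edges ss)"
  shows "is_cycle G x (ss @ [(p, e, q)])"
  using assms elementary_distinct_edges[OF assms(1,2)] chain_in_verts[OF assms(1)]
  by (auto simp: is_cycle_def chain_append)

lemma positive_cycle_circuit: "is_cycle G x ss \<Longrightarrow> chain_sign G ss = 1 \<Longrightarrow> \<exists>C. circuit G C"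
  using positive_cycleI unfolding circuit_def by blast

text \<open>
  Each of the two extra edges closes a cycle with a segment of the chain. If the segments overlap in
  an edge, the two cycles belong to a theta graph, one of whose three cycles is positive since the
  product of the three signs is \<open>1\<close>.
\<close>

lemma two_back_edges_circuit:
  assumes el: "elementary_chain G x ss y"
    and e: "e \<in> edges G" "half G e = {#p, q#}" "fst p = x" "fst q \<in> set (x # step_verts ss)"
      "e \<notin> set (chain_edges ss)"
    and f: "f \<in> edges G" "half G f = {#p', q'#}" "fst p' = y" "fst q' \<in> set (x # step_verts ss)"
      "f \<notin> set (chain_edges ss)"
    and ef: "e \<noteq> f"
  shows "\<exists>C. circuit G C"
proof -
  have c: "chain G x ss y" and d: "distinct (x # step_verts ss)"
    using el by (auto simp: elementary_chain_def chain_verts_eq)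
  have e': "half G e = {#q, p#}" and f': "half G f = {#q', p'#}"
    using e f by (auto simp: add_mset_commute)
  define u where "u = fst q"
  define w where "w = fst q'"
  obtain s1 s2 where s: "ss = s1 @ s2" "chain G x s1 u" "chain G u s2 y"
    using chain_split[OF c e(4)] u_def by metis
  obtain t1 t2 where t: "ss = t1 @ t2" "chain G x t1 w" "chain G w t2 y"
    using chain_split[OF c f(4)] w_def by metis
  have uin: "u \<in> set (x # step_verts s1)" and win: "w \<in> set (x # step_verts t1)"
    using s t chain_last by blast+
  have dt2: "distinct (w # step_verts t2)" using d t(1) win by auto
  let ?C1 = "s1 @ [(q, e, p)]" and ?C2 = "t2 @ [(p', f, q')]"
  have C1: "is_cycle G x ?C1"
    using s d e e' by (intro is_cycle_close[where y = u]) (auto simp: u_def)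
  have C2: "is_cycle G w ?C2"
    using t dt2 f by (intro is_cycle_close[where y = y]) (auto simp: w_def)
  show ?thesis
  proof (cases "chain_sign G ?C1 = 1 \<or> chain_sign G ?C2 = 1")
    case True
    then show ?thesis using positive_cycle_circuit C1 C2 by blast
  next
    case neg: False
    have N1: "negative_cycle G (set (chain_edges ?C1))" and N2: "negative_cycle G (set (chain_edges ?C2))"
      using negative_cycleI C1 C2 neg by blast+
    have V1: "verts_of G (set (chain_edges ?C1)) = insert x (set (step_verts s1))"
      and V2: "verts_of G (set (chain_edges ?C2)) = insert w (set (step_verts t2))"
      using is_cycle_verts_of(1)[OF C1] is_cycle_verts_of(1)[OF C2] e by (auto simp: w_def)
    have "s1 @ s2 = t1 @ t2" using s(1) t(1) by simp
    \<comment> \<open>Either \<open>u\<close> does not come after \<open>w\<close>, and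
      \<open>m\<close> is the gap between the two cycles, or \<open>m\<close> is their common
      segment from \<open>w\<close> to \<open>u\<close>.\<close>
    then consider m where "t1 = s1 @ m" "s2 = m @ t2"
      | m where "s1 = t1 @ m" "t2 = m @ s2" "m \<noteq> []"
      unfolding append_eq_append_conv2 by (metis append_Nil append_Nil2)
    then show ?thesis
    proof cases
      case 1
      have ss: "ss = s1 @ m @ t2" using 1 s by simp
      have "chain G x (s1 @ m) w" using t(2) 1(1) by simp
      then have m: "chain G u m w" using s(2) chain_end_unique unfolding chain_append by metis
      show ?thesis
      \<comment> \<open>An empty gap gives two negative cycles with one common vertex; otherwise
        \<open>m\<close> is the chain that joins them.\<close>
      proof (cases "m = []")
        case True
        then have "u = w" using m by simp
        then have "verts_of G (set (chain_edges ?C1)) \<inter> verts_of G (set (chain_edges ?C2)) = {u}"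
          unfolding V1 V2 using uin d ss by auto
        moreover have "set (chain_edges ?C1) \<noteq> set (chain_edges ?C2)"
        proof -
          have "e \<in> set (chain_edges ?C1)" "e \<notin> set (chain_edges ?C2)"
            using e(5) ef t(1) by auto
          then show ?thesis by blast
        qed
        ultimately have "circuit G (set (chain_edges ?C1) \<union> set (chain_edges ?C2))"
          unfolding circuit_def using N1 N2 by (metis is_singletonI is_singleton_altdef)
        then show ?thesis by blast
      next
        case False
        have wm: "w \<in> set (step_verts m)" using m False by (rule chain_end_in_step_verts)
        have "verts_of G (set (chain_edges ?C1)) \<inter> verts_of G (set (chain_edges ?C2)) = {}"
          unfolding V1 V2 using wm d ss by auto
        moreover have "elementary_chain G u m w"
          using m uin d ss by (auto simp: elementary_chain_def chain_verts_eq)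
        moreover have "u \<in> verts_of G (set (chain_edges ?C1))" "w \<in> verts_of G (set (chain_edges ?C2))"
          unfolding V1 V2 using uin by auto
        moreover have "(set (chain_verts u m) - {u, w}) \<inter>
            (verts_of G (set (chain_edges ?C1)) \<union> verts_of G (set (chain_edges ?C2))) = {}"
          unfolding V1 V2 chain_verts_eq using d ss by auto
        ultimately have "circuit G (set (chain_edges ?C1) \<union> set (chain_edges ?C2) \<union> set (chain_edges m))"
          unfolding circuit_def using N1 N2 by (intro disjI2 exI conjI) (assumption | rule refl)+
        then show ?thesis by blast
      qed
    next
      case 2
      have ss: "ss = t1 @ m @ s2" using 2 t by simp
      have "chain G x (t1 @ m) u" using s(2) 2(1) by simp
      then have m: "chain G w m u" using t(2) chain_end_unique unfolding chain_append by metis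
      have um: "u \<in> set (step_verts m)" using m 2(3) by (rule chain_end_in_step_verts)
      \<comment> \<open>The third cycle of the theta graph avoids \<open>m\<close>: along
        \<open>t1\<close> to \<open>w\<close>, over \<open>f\<close> to \<open>y\<close>, back along
        \<open>s2\<close> to \<open>u\<close>, and over \<open>e\<close> to
        \<open>x\<close>.\<close>
      let ?D = "t1 @ (q', f, p') # rev_chain s2"
      have D: "chain G x ?D u"
        using t(2) f f' chain_rev[OF s(3)] by (auto simp: chain_append w_def)
      have "x # step_verts ?D = x # step_verts t1 @ rev (u # step_verts s2)"
        using chain_verts_rev[OF s(3)] f(3) by simp
      then have dD: "distinct (x # step_verts ?D)"
        using d ss um by auto
      have C3: "is_cycle G x (?D @ [(q, e, p)])"
        using D dD e e' ef ss by (intro is_cycle_close[where y = u]) (auto simp: u_def)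
      have signs: "chain_sign G t1 \<in> {1, -1}" "chain_sign G m \<in> {1, -1}" "chain_sign G s2 \<in> {1, -1}"
        "edge_sign G e \<in> {1, -1}" "edge_sign G f \<in> {1, -1}"
        using chain_sign_in t(2) m s(3) edge_sign_in e(1) f(1) by blast+
      \<comment> \<open>The product of the two negative signs is 1 and contains the sign of
        \<open>m\<close> squared; what remains is the sign of the third cycle.\<close>
      have "chain_sign G (?D @ [(q, e, p)]) = 1"
        using neg signs unfolding 2 by auto
      then show ?thesis using positive_cycle_circuit C3 by blast
    qed
  qed
qed

section \<open>Longest elementary chains\<close>

lemma elementary_chain_length:
  assumes "elementary_chain G x ss y"
  shows "length ss < card (verts G)"
proof -
  have c: "chain G x ss y" "distinct (x # step_verts ss)"
    using assms by (auto simp: elementary_chain_def chain_verts_eq)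
  have "set (x # step_verts ss) \<subseteq> verts G"
    using c(1)
  proof (induction ss arbitrary: x)
    case (Cons s ss)
    then show ?case using half_in(1) by (cases s) fastforce
  qed simp
  then have "length (x # step_verts ss) \<le> card (verts G)"
    using c(2) finite_verts by (metis card_mono distinct_card)
  then show ?thesis by simp
qed

lemma elementary_chain_rev:
  "elementary_chain G x ss y \<Longrightarrow> elementary_chain G y (rev_chain ss) x"
  unfolding elementary_chain_def chain_verts_eq
  using chain_rev chain_verts_rev by (metis distinct_rev)

text \<open>If the other end of \<open>e\<close> were a new vertex, \<open>e\<close> would prolong
  the chain.\<close>

lemma longest_chain_back_edge:
  assumes el: "elementary_chain G x ss y"
    and longest: "\<And>x' ss' y'. elementary_chain G x' ss' y' \<Longrightarrow> length ss' \<le> length ss"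
    and e: "e \<in> edges G" "y \<in> verts_of G {e}" "e \<notin> set (chain_edges ss)"
  obtains p q where "half G e = {#p, q#}" "fst p = y" "fst q \<in> set (x # step_verts ss)"
proof -
  obtain p q where pq: "half G e = {#p, q#}" "fst p = y" using half_at e by blast
  have "fst q \<in> set (x # step_verts ss)"
  proof (rule ccontr)
    assume "fst q \<notin> set (x # step_verts ss)"
    then have "elementary_chain G x (ss @ [(p, e, q)]) (fst q)"
      using el pq e(1) half_in(2)[OF e(1) pq(1)]
      by (auto simp: elementary_chain_def chain_verts_eq chain_append)
    then show False using longest by fastforce
  qed
  then show ?thesis using that pq by blast
qed

text \<open>The assumptions \<open>deg\<close> and \<open>neg\<close> describe the support of a
  linear relation without zero vectors: a coordinate met by one edge only could not cancel, and a
  negative cycle met by no further edge would itself be dependent.\<close>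

lemma circuit_exists:
  assumes ne: "edges G \<noteq> {}"
    and deg: "\<And>e v. e \<in> edges G \<Longrightarrow> v \<in> verts_of G {e} \<Longrightarrow>
      \<exists>e'\<in>edges G. e' \<noteq> e \<and> v \<in> verts_of G {e'}"
    and neg: "\<And>C. negative_cycle G C \<Longrightarrow>
      \<exists>f\<in>edges G - C. verts_of G {f} \<inter> verts_of G C \<noteq> {}"
  shows "\<exists>C. circuit G C"
proof -
  obtain e1 where e1: "e1 \<in> edges G" using ne by auto
  obtain p1 q1 where p1: "half G e1 = {#p1, q1#}" using half_pair e1 by blast
  define P where "P n \<longleftrightarrow> (\<exists>x ss y. elementary_chain G x ss y \<and> length ss = n)" for n
  have "elementary_chain G (fst p1) [] (fst p1)"
    using half_in[OF e1 p1] by (simp add: elementary_chain_def chain_verts_eq)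
  then have "P 0" unfolding P_def by force
  moreover have "n < card (verts G)" if "P n" for n
    using that elementary_chain_length unfolding P_def by blast
  ultimately obtain n where n: "P n" "\<And>m. P m \<Longrightarrow> m \<le> n"
    using ex_has_greatest_nat[of P 0 "\<lambda>n. n" "card (verts G)"] by (metis less_imp_le)
  obtain x ss y where el: "elementary_chain G x ss y" and len: "length ss = n"
    using n unfolding P_def by blast
  have longest: "length ss' \<le> n" if "elementary_chain G x' ss' y'" for x' ss' y'
    using that n unfolding P_def by blast
  \<comment> \<open>Stated for arbitrary chains, so that it also applies to the reversed chain and
    hence to both ends.\<close>
  have end_edge: "\<exists>e\<in>edges G. y \<in> verts_of G {e} \<and> e \<notin> set (chain_edges ss)"
    if el: "elementary_chain G x ss y" and "ss \<noteq> []" for x ss y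
  proof -
    obtain ts s where ss: "ss = ts @ [s]" using \<open>ss \<noteq> []\<close> by (metis append_butlast_last_id)
    obtain p e q where s: "s = (p, e, q)" by (cases s)
    have c: "chain G x ts (fst p)" "e \<in> edges G" "half G e = {#p, q#}" "fst q = y"
      and d: "y \<notin> set (x # step_verts ts)"
      using el ss s by (auto simp: elementary_chain_def chain_verts_eq chain_append)
    have "y \<in> verts_of G {e}" using c by (auto simp: verts_of_def)
    then obtain e' where e': "e' \<in> edges G" "e' \<noteq> e" "y \<in> verts_of G {e'}"
      using deg c by blast
    \<comment> \<open>An edge of the earlier part has its ends there, and \<open>y\<close> does not
      occur there.\<close>
    have "e' \<notin> set (chain_edges ts)"
      using chain_verts_of[OF c(1)] verts_of_mono[of "{e'}" "set (chain_edges ts)"] e' d by auto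
    then show ?thesis using e' ss s by auto
  qed
  show ?thesis
  proof (cases "n = 0")
    case True
    \<comment> \<open>The longest chain is trivial, so two edges at \<open>?v\<close> are both
      loops, and the empty chain serves.\<close>
    let ?v = "fst p1"
    have v: "elementary_chain G ?v [] ?v"
      using half_in[OF e1 p1] by (simp add: elementary_chain_def chain_verts_eq)
    have v1: "?v \<in> verts_of G {e1}" using p1 by (auto simp: verts_of_def)
    then obtain e2 where e2: "e2 \<in> edges G" "e2 \<noteq> e1" "?v \<in> verts_of G {e2}"
      using deg e1 by blast
    obtain p q where e: "half G e1 = {#p, q#}" "fst p = ?v" "fst q = ?v"
      by (rule longest_chain_back_edge[OF v _ e1 v1]) (use longest True in auto)
    obtain p' q' where f: "half G e2 = {#p', q'#}" "fst p' = ?v" "fst q' = ?v"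
      by (rule longest_chain_back_edge[OF v _ e2(1,3)]) (use longest True in auto)
    show ?thesis
      using two_back_edges_circuit[OF v e1 e(1,2) _ _ e2(1) f(1,2)] e(3) f(3) e2(2) by simp
  next
    case False
    then have "ss \<noteq> []" using len by auto
    obtain f where f: "f \<in> edges G" "y \<in> verts_of G {f}" "f \<notin> set (chain_edges ss)"
      using end_edge[OF el \<open>ss \<noteq> []\<close>] by blast
    have elr: "elementary_chain G y (rev_chain ss) x" using el by (rule elementary_chain_rev)
    obtain e where e: "e \<in> edges G" "x \<in> verts_of G {e}" "e \<notin> set (chain_edges ss)"
    proof -
      have "rev_chain ss \<noteq> []" using \<open>ss \<noteq> []\<close> by (simp add: rev_chain_def)
      from end_edge[OF elr this] show ?thesis using that by auto
    qed
    have c: "chain G x ss y" and d: "distinct (x # step_verts ss)"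
      using el by (auto simp: elementary_chain_def chain_verts_eq)
    obtain p' q' where f': "half G f = {#p', q'#}" "fst p' = y" "fst q' \<in> set (x # step_verts ss)"
      by (rule longest_chain_back_edge[OF el _ f]) (use longest len in auto)
    obtain p q where e': "half G e = {#p, q#}" "fst p = x" "fst q \<in> set (y # step_verts (rev_chain ss))"
      by (rule longest_chain_back_edge[OF elr _ e(1,2)]) (use longest len e(3) in auto)
    show ?thesis
    proof (cases "e = f")
      case False
      have "fst q \<in> set (x # step_verts ss)"
        using e'(3) unfolding chain_verts_rev[OF c] by simp
      then show ?thesis
        using two_back_edges_circuit[OF el e(1) e'(1,2) _ e(3) f(1) f'(1,2,3) f(3) False] by blast
    next
      case True
      \<comment> \<open>A single back edge for both ends must join \<open>y\<close> to
        \<open>x\<close>, so it closes the whole chain to a cycle.\<close>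
      have "x \<noteq> y" using d chain_end_in_step_verts[OF c \<open>ss \<noteq> []\<close>] by auto
      then have "fst q' = x" using True e'(1,2) f'(1,2) by (auto simp: pair_mset_eq_iff)
      then have cyc: "is_cycle G x (ss @ [(p', f, q')])"
        using is_cycle_close[OF c d f(1) f'(1,2) _ f(3)] by blast
      show ?thesis
      proof (cases "chain_sign G (ss @ [(p', f, q')]) = 1")
        case True
        then show ?thesis using positive_cycle_circuit cyc by blast
      next
        case False
        let ?C = "set (chain_edges (ss @ [(p', f, q')]))"
        have N: "negative_cycle G ?C" using negative_cycleI[OF cyc False] .
        obtain g z where g: "g \<in> edges G" "g \<notin> ?C" "z \<in> verts_of G {g}" "z \<in> verts_of G ?C"
          using neg[OF N] by blast
        obtain ts where ts: "is_cycle G z ts" "?C = set (chain_edges ts)"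
          using cycle_rotate[OF _ g(4)] N unfolding negative_cycle_def by metis
        \<comment> \<open>Opening the cycle at \<open>z\<close> by removing its edge
          \<open>h\<close> leaves a chain \<open>rs\<close> that is again longest; \<open>h\<close>
          is a back edge at its start, and the outside edge \<open>g\<close> is a different one at
          its end \<open>z\<close>.\<close>
        then obtain a h b rs where r: "ts = (a, h, b) # rs" by (cases ts) (auto simp: is_cycle_def)
        have h: "h \<in> edges G" "half G h = {#b, a#}" "fst a = z" "chain G (fst b) rs z"
          "h \<notin> set (chain_edges rs)"
          using ts r by (auto simp: is_cycle_def add_mset_commute)
        have elz: "elementary_chain G (fst b) rs z"
          using ts r h by (auto simp: is_cycle_def elementary_chain_def chain_verts_eq)
        have "length (chain_edges ts) = length (chain_edges (ss @ [(p', f, q')]))"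
          using ts cyc by (metis distinct_card is_cycle_def)
        then have lrs: "length rs = n" using r len by (simp add: chain_edges_def)
        have gn: "g \<notin> set (chain_edges rs)" "h \<noteq> g" using g ts r by auto
        obtain p2 q2 where g': "half G g = {#p2, q2#}" "fst p2 = z" "fst q2 \<in> set (fst b # step_verts rs)"
          by (rule longest_chain_back_edge[OF elz _ g(1,3) gn(1)]) (use longest lrs in auto)
        have "fst a \<in> set (fst b # step_verts rs)" using chain_last[OF h(4)] h(3) by simp
        then show ?thesis
          using two_back_edges_circuit[OF elz h(1,2) refl _ h(5) g(1) g' gn] by blast
      qed
    qed
  qed
qed


section \<open>Coordinates of edge vectors\<close>

lemma edge_vec_outside: "e \<in> edges G \<Longrightarrow> v \<notin> verts_of G {e} \<Longrightarrow> edge_vec G e v = 0"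
proof -
  assume e: "e \<in> edges G" "v \<notin> verts_of G {e}"
  obtain p q where pq: "half G e = {#p, q#}" using half_pair e by blast
  then have "fst p \<noteq> v" "fst q \<noteq> v" using e(2) by (auto simp: verts_of_def)
  then show ?thesis by (simp add: edge_vec_pair[OF pq] fscale_apply)
qed

text \<open>The vector of a loop is a multiple of a unit vector; any other edge has coefficient +1
  or -1 at each end.\<close>

lemma edge_vec_at:
  assumes "e \<in> edges G" "v \<in> verts_of G {e}" "edge_vec G e \<noteq> 0"
  shows "edge_vec G e v \<noteq> 0"
proof -
  obtain p q where pq: "half G e = {#p, q#}" "fst p = v" using half_at assms by blast
  show ?thesis
  proof (cases "fst q = v")
    case True
    then have "edge_vec G e = fscale (edge_vec G e v) (unit_vec v)"
      using pq(2) by (auto simp: edge_vec_pair[OF pq(1)] fscale_apply fun_eq_iff)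
    then show ?thesis using assms(3) by (metis funs.scale_zero_left)
  next
    case False
    then show ?thesis using pq half_in(3)[OF assms(1) pq(1)]
      by (auto simp: edge_vec_pair[OF pq(1)] fscale_apply)
  qed
qed

text \<open>The vector vanishes only for a loop with opposite signs, which is a positive
  cycle.\<close>

lemma edge_vec_zero_circuit:
  assumes "e \<in> edges G" "edge_vec G e = 0"
  shows "circuit G {e}"
proof -
  obtain p q where pq: "half G e = {#p, q#}" using half_pair assms by blast
  have "edge_vec G e (fst p) = 0" using assms by simp
  then have eq: "fst p = fst q" "snd p = - snd q"
    using half_in(3,4)[OF assms(1) pq]
    by (auto simp: edge_vec_pair[OF pq] fscale_apply split: if_splits)
  then have "is_cycle G (fst p) [(p, e, q)]"
    using assms pq half_in[OF assms(1) pq] by (auto simp: is_cycle_def)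
  moreover have "chain_sign G [(p, e, q)] = 1"
    using eq half_in(4)[OF assms(1) pq] by (auto simp: edge_sign_pair[OF pq])
  ultimately have "positive_cycle G (set (chain_edges [(p, e, q)]))" by (rule positive_cycleI)
  then show ?thesis by (simp add: circuit_def)
qed

end

section \<open>Restriction to a subset of the edges\<close>

lemma chain_restrict:
  "chain (G\<lparr>edges := F\<rparr>) x ss y \<Longrightarrow> F \<subseteq> edges G \<Longrightarrow> chain G x ss y"
  by (induction ss arbitrary: x) fastforce+

text \<open>Signs and vertex sets depend only on \<open>half\<close>, so restriction affects only
  which chains exist.\<close>

lemma circuit_restrict:
  assumes "circuit (G\<lparr>edges := F\<rparr>) C" "F \<subseteq> edges G"
  shows "circuit G C"
proof -
  let ?H = "G\<lparr>edges := F\<rparr>"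
  have cyc: "cycle G D" if "cycle ?H D" for D
    using that chain_restrict[OF _ assms(2)] unfolding cycle_def by blast
  have sgn: "edge_sign ?H = edge_sign G" by (simp add: edge_sign_def fun_eq_iff)
  have pos: "positive_cycle G D" if "positive_cycle ?H D" for D
    using that cyc by (auto simp: positive_cycle_def sgn)
  have neg: "negative_cycle G D" if "negative_cycle ?H D" for D
    using that cyc by (auto simp: negative_cycle_def sgn)
  have vs: "verts_of ?H = verts_of G" by (simp add: verts_of_def fun_eq_iff)
  have el: "elementary_chain G x ss y" if "elementary_chain ?H x ss y" for x ss y
    using that chain_restrict[OF _ assms(2)] unfolding elementary_chain_def by blast
  from assms(1) show ?thesis
    unfolding circuit_def vs by (elim disjE exE conjE) (metis pos neg el)+
qed

context bidirected
begin

section \<open>Matroid independence as linear independence\<close>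

text \<open>Restrict to the support \<open>S\<close> of a linear relation. A zero vector there is a
  circuit by itself; otherwise \<open>circuit_exists\<close> applies to the graph with edge set
  \<open>S\<close>.\<close>

lemma dependent_imp_circuit:
  assumes F: "F \<subseteq> edges G" and dep: "family_dependent (edge_vec G) F"
  shows "\<exists>C\<subseteq>F. circuit G C"
proof -
  have finF: "finite F" using F finite_edges finite_subset by blast
  obtain c where c: "(\<Sum>e\<in>F. fscale (c e) (edge_vec G e)) = 0" "\<exists>e\<in>F. c e \<noteq> 0"
    using family_dependent_imp_relation[OF finF dep] by blast
  define S where "S = {e \<in> F. c e \<noteq> 0}"
  have S: "finite S" "S \<subseteq> F" "S \<noteq> {}" "S \<subseteq> edges G" using finF c F by (auto simp: S_def)
  have rel: "(\<Sum>e\<in>S. c e * edge_vec G e v) = 0" for v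
  proof -
    have "(\<Sum>e\<in>S. c e * edge_vec G e v) = (\<Sum>e\<in>F. c e * edge_vec G e v)"
      by (rule sum.mono_neutral_left[OF finF S(2)]) (auto simp: S_def)
    also have "\<dots> = (\<Sum>e\<in>F. fscale (c e) (edge_vec G e)) v"
      by (simp add: sum_fun_apply fscale_apply)
    finally show ?thesis using c(1) by simp
  qed
  show ?thesis
  proof (cases "\<exists>e\<in>S. edge_vec G e = 0")
    case True
    then obtain e where e: "e \<in> S" "edge_vec G e = 0" by blast
    then have "circuit G {e}" using S(4) by (intro edge_vec_zero_circuit) auto
    then show ?thesis using e(1) S(2) by (intro exI[of _ "{e}"]) auto
  next
    case False
    let ?H = "G\<lparr>edges := S\<rparr>"
    interpret H: bidirected ?H
      using bidirected S by unfold_locales (auto simp: bidirected_graph_def)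
    have vs: "verts_of ?H = verts_of G" by (simp add: verts_of_def fun_eq_iff)
    have ev: "edge_vec ?H = edge_vec G" by (simp add: edge_vec_def fun_eq_iff)
    have "\<exists>C. circuit ?H C"
    proof (rule H.circuit_exists)
      show "edges ?H \<noteq> {}" using S by simp
    next
      fix e v assume e: "e \<in> edges ?H" "v \<in> verts_of ?H {e}"
      then have eS: "e \<in> S" and v: "v \<in> verts_of G {e}" by (simp_all add: vs)
      show "\<exists>e'\<in>edges ?H. e' \<noteq> e \<and> v \<in> verts_of ?H {e'}"
      proof (rule ccontr)
        assume "\<not> ?thesis"
        then have "v \<notin> verts_of G {e'}" if "e' \<in> S - {e}" for e'
          using that by (auto simp: vs)
        then have "\<forall>e'\<in>S - {e}. c e' * edge_vec G e' v = 0"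
          using edge_vec_outside S(4) by (metis DiffD1 mult_zero_right subsetD)
        \<comment> \<open>If \<open>e\<close> were the only edge of \<open>S\<close> at
          \<open>v\<close>, this single nonzero term would be the whole coordinate of the
          relation.\<close>
        then have "(\<Sum>e\<in>S. c e * edge_vec G e v) = c e * edge_vec G e v"
          using S(1) eS by (simp only: sum.remove sum.neutral add_0_right)
        then show False
          using rel[of v] edge_vec_at[of e v] False eS v S(4) by (auto simp: S_def)
      qed
    next
      fix C assume C: "negative_cycle ?H C"
      obtain x ss where ss: "is_cycle ?H x ss" "C = set (chain_edges ss)"
        using C by (auto simp: negative_cycle_def cycle_iff)
      have CS: "C \<subseteq> S" "C \<noteq> {}"
        using ss H.chain_edges_subset[of x ss x] by (auto simp: is_cycle_def chain_edges_def)
      show "\<exists>f\<in>edges ?H - C. verts_of ?H {f} \<inter> verts_of ?H C \<noteq> {}"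
      proof (rule ccontr)
        assume "\<not> ?thesis"
        then have out: "verts_of G {f} \<inter> verts_of G C = {}" if "f \<in> S - C" for f
          using that by (auto simp: vs)
        \<comment> \<open>The relation splits: at vertices of \<open>C\<close> the other edges
          contribute nothing, and elsewhere the edges of \<open>C\<close> contribute
          nothing.\<close>
        have "(\<Sum>e\<in>C. c e * edge_vec G e v) = 0" for v
        proof (cases "v \<in> verts_of G C")
          case True
          have "(\<Sum>e\<in>C. c e * edge_vec G e v) = (\<Sum>e\<in>S. c e * edge_vec G e v)"
          proof (rule sum.mono_neutral_left[OF S(1) CS(1)], intro ballI)
            fix f assume f: "f \<in> S - C"
            then have "v \<notin> verts_of G {f}" using out True by blast
            then show "c f * edge_vec G f v = 0" using edge_vec_outside f S(4) by auto
          qed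
          then show ?thesis using rel by simp
        next
          case False
          have "edge_vec G e v = 0" if "e \<in> C" for e
          proof (rule edge_vec_outside)
            show "e \<in> edges G" using that CS S by auto
            show "v \<notin> verts_of G {e}" using that False verts_of_mono[of "{e}" C] by auto
          qed
          then show ?thesis by simp
        qed
        then have "(\<Sum>e\<in>C. fscale (c e) (edge_vec ?H e)) = 0"
          by (simp add: fun_eq_iff sum_fun_apply fscale_apply ev)
        moreover obtain e where e: "e \<in> C" using CS by auto
        moreover have "c e \<noteq> 0" using e CS by (auto simp: S_def)
        moreover have "finite C" using ss by simp
        ultimately have "family_dependent (edge_vec ?H) C"
          by (intro relation_imp_family_dependent[where c = c and e = e])
        then show False using H.negative_cycle_independent C by blast
      qed
    qed
    then obtain C where C: "circuit ?H C" by blast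
    have "C \<subseteq> F" using H.circuit_subset[OF C] S by auto
    then show ?thesis using circuit_restrict[OF C S(4)] by blast
  qed
qed

lemma matroid_independent_iff:
  "independent (bigraph_matroid G) I \<longleftrightarrow> I \<subseteq> edges G \<and> \<not> family_dependent (edge_vec G) I"
proof -
  have "independent (bigraph_matroid G) I \<longleftrightarrow> I \<subseteq> edges G \<and> \<not> (\<exists>C\<subseteq>I. circuit G C)"
    by (auto simp: independent_def bigraph_matroid_def)
  then show ?thesis
    using dependent_imp_circuit[of I] circuit_dependent family_dependent_mono by metis
qed

lemma finite_independent: "finite {I. independent (bigraph_matroid G) I}"
  by (rule finite_subset[of _ "Pow (edges G)"]) (auto simp: matroid_independent_iff finite_edges)

end

section \<open>Rank as dimension of the span\<close>

text \<open>A basis chosen among the edge vectors of \<open>H\<close> bounds every independent set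
  of \<open>G\<close>. The edge types may differ, as they do for the transitive closure.\<close>

lemma matroid_rank_mono:
  fixes G :: "('v, 'e) bigraph" and H :: "('v, 'f) bigraph"
  assumes "bidirected_graph G" "bidirected_graph H"
    and sub: "edge_vec G ` edges G \<subseteq> funs.span (edge_vec H ` edges H)"
  shows "matroid_rank (bigraph_matroid G) \<le> matroid_rank (bigraph_matroid H)"
proof -
  interpret G: bidirected G by unfold_locales fact
  interpret H: bidirected H by unfold_locales fact
  obtain B where B: "B \<subseteq> edge_vec H ` edges H" "\<not> funs.dependent B"
    "edge_vec H ` edges H \<subseteq> funs.span B"
    using funs.maximal_independent_subset by blast
  \<comment> \<open>One edge is chosen for each basis vector, which makes \<open>J\<close> an
    independent family as large as the basis.\<close>
  obtain J where J: "J \<subseteq> edges H" "inj_on (edge_vec H) J" "edge_vec H ` J = B"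
    using B(1) by (metis subset_image_inj)
  have finB: "finite B" using B(1) H.finite_edges finite_surj by blast
  have "independent (bigraph_matroid H) J"
    using J B(2) by (simp add: H.matroid_independent_iff family_dependent_iff)
  then have "card J \<le> matroid_rank (bigraph_matroid H)"
    unfolding matroid_rank_def using H.finite_independent by (intro Max_ge) auto
  moreover have "card I \<le> card J" if "independent (bigraph_matroid G) I" for I
  proof -
    have I: "I \<subseteq> edges G" "inj_on (edge_vec G) I" "\<not> funs.dependent (edge_vec G ` I)"
      using that by (auto simp: G.matroid_independent_iff family_dependent_iff)
    have "funs.span (edge_vec H ` edges H) \<subseteq> funs.span B"
      using B(3) by (simp add: funs.span_minimal)
    then have "edge_vec G ` I \<subseteq> funs.span B" using I(1) sub by auto
    from funs.independent_span_bound[OF finB I(3) this]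
    have "card (edge_vec G ` I) \<le> card B" by (rule conjunct2)
    then show ?thesis using card_image[OF I(2)] card_image[OF J(2)] J(3) by simp
  qed
  moreover have "independent (bigraph_matroid G) {}"
    by (simp add: G.matroid_independent_iff family_dependent_def)
  ultimately show ?thesis
    unfolding matroid_rank_def[of "bigraph_matroid G"]
    using G.finite_independent by (intro Max.boundedI) (auto intro: order_trans)
qed

section \<open>b-walks\<close>

lemma chain_step:
  "chain G x ss y \<Longrightarrow> s \<in> set ss \<Longrightarrow>
     step_edge s \<in> edges G \<and> half G (step_edge s) = {#step_src s, step_tgt s#}"
  by (induction ss arbitrary: x) fastforce+

text \<open>Induction removes the first edge: the tail starts at the same vertex with the opposite
  sign, so the two terms there cancel. A repeated edge is added repeatedly, which stays in the
  span.\<close>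

lemma b_walk_span:
  "b_walk G p ss q \<Longrightarrow>
     fscale (real_of_int (snd p)) (unit_vec (fst p)) + fscale (real_of_int (snd q)) (unit_vec (fst q))
       \<in> funs.span (edge_vec G ` edges G)"
proof (induction ss arbitrary: p)
  case Nil
  then show ?case by (simp add: b_walk_def)
next
  case (Cons s ts)
  obtain r e where s: "s = (p, e, r)"
    using Cons.prems by (cases s) (auto simp: b_walk_def)
  have e: "e \<in> edges G" "half G e = {#p, r#}" "chain G (fst r) ts (fst q)"
    using Cons.prems s by (auto simp: b_walk_def)
  have ve: "fscale (real_of_int (snd p)) (unit_vec (fst p)) + fscale (real_of_int (snd r)) (unit_vec (fst r))
       \<in> funs.span (edge_vec G ` edges G)"
    using e(1) unfolding edge_vec_pair[OF e(2), symmetric] by (intro funs.span_base) auto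
  show ?case
  proof (cases ts)
    case Nil
    then have "r = q" using Cons.prems s by (simp add: b_walk_def)
    then show ?thesis using ve by (simp only:)
  next
    case (Cons s' us)
    obtain r' e' q' where s': "s' = (r', e', q')" by (cases s')
    have r': "fst r' = fst r" using e(3) Cons s' by simp
    have alt: "\<forall>i. Suc i < length (s # ts) \<longrightarrow>
        snd (step_tgt ((s # ts) ! i)) + snd (step_src ((s # ts) ! Suc i)) = 0"
      using Cons.prems by (simp add: b_walk_def)
    have "snd r + snd r' = 0" using alt[rule_format, of 0] Cons s s' by simp
    then have sr: "snd r = - snd r'" by simp
    have "b_walk G r' ts q"
      unfolding b_walk_def
    proof (intro conjI allI impI)
      show "ts \<noteq> []" "step_src (hd ts) = r'" using Cons s' by auto
      show "chain G (fst r') ts (fst q)" using e(3) r' by simp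
      show "step_tgt (last ts) = q" using Cons.prems Cons by (simp add: b_walk_def)
      show "snd (step_tgt (ts ! i)) + snd (step_src (ts ! Suc i)) = 0" if "Suc i < length ts" for i
        using alt[rule_format, of "Suc i"] that by simp
    qed
    from Cons.IH[OF this]
    have "fscale (real_of_int (snd r')) (unit_vec (fst r')) + fscale (real_of_int (snd q)) (unit_vec (fst q))
       \<in> funs.span (edge_vec G ` edges G)" .
    moreover have "fscale (real_of_int (snd r')) (unit_vec (fst r')) =
        - fscale (real_of_int (snd r)) (unit_vec (fst r))"
      using sr r' by simp
    ultimately show ?thesis using funs.span_add[OF ve]
      by (metis (no_types, lifting) add.assoc add_minus_cancel)
  qed
qed

lemma b_walk_ends:
  assumes "bidirected_graph G" "b_walk G p ss q"
  shows "p \<in> verts G \<times> {1, -1}" "q \<in> verts G \<times> {1, -1}"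
proof -
  interpret bidirected G by unfold_locales fact
  have c: "ss \<noteq> []" "chain G (fst p) ss (fst q)" "step_src (hd ss) = p" "step_tgt (last ss) = q"
    using assms(2) by (auto simp: b_walk_def)
  note h = chain_step[OF c(2) hd_in_set[OF c(1)]] and l = chain_step[OF c(2) last_in_set[OF c(1)]]
  show "p \<in> verts G \<times> {1, -1}"
    using half_in(1,3)[OF conjunct1[OF h] conjunct2[OF h]] c(3) by (cases p) auto
  show "q \<in> verts G \<times> {1, -1}"
    using half_in(2,4)[OF conjunct1[OF l] conjunct2[OF l]] c(4) by (cases q) auto
qed

text \<open>The added edges are unordered pairs from the finite set of signed vertices, because the
  ends of a b-walk are half-edges of the graph.\<close>

lemma bidirected_transitive_closure:
  assumes "bidirected_graph G"
  shows "bidirected_graph (transitive_closure G)"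
proof -
  let ?N = "{{#p, q#} | p q. \<exists>ss. b_path G p ss q}"
  have ends: "p \<in> verts G \<times> {1, -1}" "q \<in> verts G \<times> {1, -1}" if "b_path G p ss q" for p q ss
    using that b_walk_ends[OF assms] unfolding b_path_def by blast+
  have "?N \<subseteq> (\<lambda>(p, q). {#p, q#}) ` ((verts G \<times> {1, -1}) \<times> (verts G \<times> {1, -1}))"
    using ends by fastforce
  moreover have "finite (verts G)" using assms by (simp add: bidirected_graph_def)
  ultimately have "finite ?N" by (meson finite.simps finite_SigmaI finite_imageI finite_subset)
  moreover have "\<exists>x\<in>verts G. \<exists>y\<in>verts G. \<exists>a\<in>{1, -1}. \<exists>b\<in>{1, -1}.
      half (transitive_closure G) t = {#(x, a), (y, b)#}" if "t \<in> edges (transitive_closure G)" for t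
    using that unfolding transitive_closure_def bigraph.simps
  proof (elim UnE imageE)
    fix e assume "e \<in> edges G" "t = Inl e"
    then show "\<exists>x\<in>verts G. \<exists>y\<in>verts G. \<exists>a\<in>{1, -1}. \<exists>b\<in>{1, -1}.
        case_sum (half G) id t = {#(x, a), (y, b)#}"
      using assms unfolding bidirected_graph_def by simp
  next
    fix m assume m: "m \<in> ?N" "t = Inr m"
    then obtain p q ss where "m = {#p, q#}" "b_path G p ss q" by blast
    then show "\<exists>x\<in>verts G. \<exists>y\<in>verts G. \<exists>a\<in>{1, -1}. \<exists>b\<in>{1, -1}.
        case_sum (half G) id t = {#(x, a), (y, b)#}"
      using ends[of p ss q] m(2) by (cases p, cases q) auto
  qed
  ultimately show ?thesis
    using assms unfolding bidirected_graph_def by (simp add: transitive_closure_def)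
qed

section \<open>Equality of the three ranks\<close>

theorem theorem57:
  fixes G R :: "('v, 'e) bigraph"
  assumes "bidirected_graph G" and "transitive_reduction R G"
  shows "matroid_rank (bigraph_matroid (transitive_closure G)) = matroid_rank (bigraph_matroid G) \<and>
         matroid_rank (bigraph_matroid G) = matroid_rank (bigraph_matroid R)"
proof
  let ?T = "transitive_closure G"
  have T: "bidirected_graph ?T" using assms(1) by (rule bidirected_transitive_closure)
  have Inl: "edge_vec ?T (Inl e) = edge_vec G e" for e
    by (simp add: edge_vec_def transitive_closure_def)
  have "edge_vec ?T ` edges ?T \<subseteq> funs.span (edge_vec G ` edges G)"
  proof (rule image_subsetI)
    fix t assume "t \<in> edges ?T"
    then consider e where "t = Inl e" "e \<in> edges G"
      | p q ss where "t = Inr {#p, q#}" "b_path G p ss q"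
      by (auto simp: transitive_closure_def)
    then show "edge_vec ?T t \<in> funs.span (edge_vec G ` edges G)"
    proof cases
      case 1
      then show ?thesis by (simp add: Inl funs.span_base)
    next
      case 2
      then have "half ?T t = {#p, q#}" by (simp add: transitive_closure_def)
      from edge_vec_pair[OF this] b_walk_span[of G p ss q] 2(2) show ?thesis
        by (simp only: b_path_def)
    qed
  qed
  moreover have "edge_vec G ` edges G \<subseteq> funs.span (edge_vec ?T ` edges ?T)"
  proof (rule image_subsetI)
    fix e assume "e \<in> edges G"
    then have "Inl e \<in> edges ?T" by (simp add: transitive_closure_def)
    then show "edge_vec G e \<in> funs.span (edge_vec ?T ` edges ?T)"
      unfolding Inl[symmetric] by (intro funs.span_base imageI)
  qed
  ultimately show "matroid_rank (bigraph_matroid ?T) = matroid_rank (bigraph_matroid G)"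
    using matroid_rank_mono[OF assms(1) T] matroid_rank_mono[OF T assms(1)] by (intro antisym)

  have R: "verts R = verts G" "edges R \<subseteq> edges G" "\<forall>e\<in>edges R. half R e = half G e"
    and cl: "closure_in G R = G"
    using assms(2) by (auto simp: transitive_reduction_def partial_graph_def)
  have bR: "bidirected_graph R"
    using assms(1) R finite_subset[OF R(2)] unfolding bidirected_graph_def by (simp add: subset_iff)
  have vR: "edge_vec R e = edge_vec G e" if "e \<in> edges R" for e
    using R(3) that by (simp add: edge_vec_def)
  have "edge_vec G ` edges G \<subseteq> funs.span (edge_vec R ` edges R)"
  proof (rule image_subsetI)
    fix e assume "e \<in> edges G"
    \<comment> \<open>Since the closure of \<open>R\<close> is all of \<open>G\<close>, each edge of
      \<open>G\<close> lies in \<open>R\<close> or is spanned along a b-path of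
      \<open>R\<close>.\<close>
    then have "e \<in> edges (closure_in G R)" using cl by simp
    then consider "e \<in> edges R" | p q ss where "half G e = {#p, q#}" "b_path R p ss q"
      by (auto simp: closure_in_def)
    then show "edge_vec G e \<in> funs.span (edge_vec R ` edges R)"
    proof cases
      case 1
      then show ?thesis using vR by (metis funs.span_base imageI)
    next
      case 2
      from edge_vec_pair[OF 2(1)] b_walk_span[of R p ss q] 2(2) show ?thesis
        by (simp only: b_path_def)
    qed
  qed
  moreover have "edge_vec R ` edges R \<subseteq> funs.span (edge_vec G ` edges G)"
  proof (rule image_subsetI)
    fix e assume e: "e \<in> edges R"
    then have "edge_vec G e \<in> edge_vec G ` edges G" using R(2) by auto
    then show "edge_vec R e \<in> funs.span (edge_vec G ` edges G)"
      unfolding vR[OF e] by (rule funs.span_base)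
  qed
  ultimately show "matroid_rank (bigraph_matroid G) = matroid_rank (bigraph_matroid R)"
    using matroid_rank_mono[OF assms(1) bR] matroid_rank_mono[OF bR assms(1)] by (intro antisym)
qed

end
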